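(* Let $\frac{dJ(K)}{dK}\in\mathbb{R}^{m\times n}$ be the (non-null) gradient of the cost $J$ at the gain matrix $K\in\mathbb{R}^{m\times n}$. The following statements hold. (i) Let $G$ be a full row rank matrix with $m$ columns and $H$ a full column rank matrix with $n$ rows. The gradient projected onto the single constrained hyperplane $C(D)=GDH=0$ is $$D=\frac{dJ(K)}{dK}-G^T\left(GG^T\right)^{-1}G\,\frac{dJ(K)}{dK}\,H\left(H^TH\right)^{-1}H^T .$$ (ii) Let $G_1,\dots,G_N$ be full row rank matrices with $m$ columns each and $H_1,\dots,H_N$ full column rank matrices with $n$ rows each. The gradient projected onto the multiple constrained hyperplanes $C_i(D)=G_iDH_i=0$, $i=1,\dots,N$, is $$D=\frac{dJ(K)}{dK}-\sum_{i=1}^N G_i^T\Lambda_iH_i^T ,$$ where the matrices $\Lambda_i$, $i=1,\dots,N$, can be obtained by solving the system of equations $$G_l\,\frac{dJ(K)}{dK}\,H_l=\sum_{i=1}^N G_lG_i^T\Lambda_iH_i^TH_l,\qquad l=1,\dots,N .$$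
   Context: The gradient projected onto the constrained hyperplane $C(D)=0$ is the optimal solution $D\in\mathbb{R}^{m\times n}$ of $$\min_D\ \tfrac12\left\|\frac{dJ(K)}{dK}-D\right\|_F^2\quad\text{subject to } C(D)=0,$$ where $\|\cdot\|_F$ is the Frobenius norm; for multiple constraints, it is the optimal solution of the same problem subject to $C_i(D)=0$ for all $i=1,\dots,N$. The matrix $\Lambda_i$ is the Lagrange multiplier of the $i$th constraint and has the size of $G_iDH_i$. Here $J(K)=\int_0^\infty\frac12(x^TQx+u^TRu)\,dt$ is the LQR cost of the closed loop formed by $\dot x=Ax+Bu$, $u=Kx$ ($A\in\mathbb{R}^{n\times n}$, $B\in\mathbb{R}^{n\times m}$, $Q\succeq0$, $R\succ0$, $K$ stabilizing); for this statement only its gradient matrix at $K$ matters. *)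

theory Defs
  imports
    "HOL-Analysis.Henstock_Kurzweil_Integration"
    "Jordan_Normal_Form.DL_Rank"
    "Jordan_Normal_Form.Char_Poly"
    "Jordan_Normal_Form.Gauss_Jordan_Elimination"
begin

(* \<bullet> and $ denote the operations on Jordan_Normal_Form vectors here *)
unbundle no inner_syntax
no_notation Finite_Cartesian_Product.vec_nth (infixl \<open>$\<close> 90)

definition pos_semidef :: "nat \<Rightarrow> real mat \<Rightarrow> bool" where
  "pos_semidef n M \<longleftrightarrow>
     M \<in> carrier_mat n n \<and> M\<^sup>T = M \<and> (\<forall>v \<in> carrier_vec n. 0 \<le> v \<bullet> (M *\<^sub>v v))"

definition pos_def :: "nat \<Rightarrow> real mat \<Rightarrow> bool" where
  "pos_def n M \<longleftrightarrow>
     M \<in> carrier_mat n n \<and> M\<^sup>T = M \<and>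
     (\<forall>v \<in> carrier_vec n. v \<noteq> 0\<^sub>v n \<longrightarrow> 0 < v \<bullet> (M *\<^sub>v v))"

definition stabilizing :: "real mat \<Rightarrow> real mat \<Rightarrow> real mat \<Rightarrow> bool" where
  "stabilizing A B K \<longleftrightarrow>
     (\<forall>z. eigenvalue (map_mat complex_of_real (A + B * K)) z \<longrightarrow> Re z < 0)"

definition closed_loop_trajectory ::
  "real mat \<Rightarrow> real mat \<Rightarrow> real mat \<Rightarrow> real vec \<Rightarrow> (real \<Rightarrow> real vec) \<Rightarrow> bool" where
  "closed_loop_trajectory A B K x0 x \<longleftrightarrow>
     x 0 = x0 \<and>
     (\<forall>t\<ge>0. x t \<in> carrier_vec (dim_vec x0) \<and>
       (\<forall>i < dim_vec x0. ((\<lambda>s. x s $ i) has_real_derivative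
          (A *\<^sub>v x t + B *\<^sub>v (K *\<^sub>v x t)) $ i) (at t within {0..})))"

(* The trajectory is determined by x0 on {0..}, so the choice made by SOME (which concerns
   negative times only) does not affect the integral. *)
definition lqr_cost ::
  "real mat \<Rightarrow> real mat \<Rightarrow> real mat \<Rightarrow> real mat \<Rightarrow> real vec \<Rightarrow> real mat \<Rightarrow> real" where
  "lqr_cost A B Q R x0 K =
     (let x = (SOME x. closed_loop_trajectory A B K x0 x);
          u = (\<lambda>t. K *\<^sub>v x t)
      in integral {0..} (\<lambda>t. 1/2 * (x t \<bullet> (Q *\<^sub>v x t) + u t \<bullet> (R *\<^sub>v u t))))"

definition unit_mat :: "nat \<Rightarrow> nat \<Rightarrow> nat \<Rightarrow> nat \<Rightarrow> real mat" where
  "unit_mat m n i j = mat m n (\<lambda>kl. if kl = (i, j) then 1 else 0)"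

(* g is the matrix of partial derivatives of f with respect to the entries of the argument, at X *)
definition has_matrix_gradient :: "(real mat \<Rightarrow> real) \<Rightarrow> real mat \<Rightarrow> real mat \<Rightarrow> bool" where
  "has_matrix_gradient f X g \<longleftrightarrow>
     g \<in> carrier_mat (dim_row X) (dim_col X) \<and>
     (\<forall>i < dim_row X. \<forall>j < dim_col X.
        ((\<lambda>t. f (X + t \<cdot>\<^sub>m unit_mat (dim_row X) (dim_col X) i j))
           has_real_derivative g $$ (i, j)) (at 0))"

(* vec_space.rank is the dimension of the column space; its first argument is the number of rows *)
definition full_row_rank :: "real mat \<Rightarrow> bool" where
  "full_row_rank M \<longleftrightarrow> vec_space.rank (dim_row M) M = dim_row M"

definition full_col_rank :: "real mat \<Rightarrow> bool" where
  "full_col_rank M \<longleftrightarrow> vec_space.rank (dim_row M) M = dim_col M"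

abbreviation mat_inv :: "real mat \<Rightarrow> real mat" where
  "mat_inv M \<equiv> the (mat_inverse M)"

abbreviation mat_sum :: "nat \<Rightarrow> nat \<Rightarrow> (nat \<Rightarrow> real mat) \<Rightarrow> nat set \<Rightarrow> real mat" where
  "mat_sum r c f I \<equiv> finsum (module_mat TYPE(real) r c) f I"

definition frob_inner :: "real mat \<Rightarrow> real mat \<Rightarrow> real" where
  "frob_inner X Y = (\<Sum>i < dim_row X. \<Sum>j < dim_col X. X $$ (i, j) * Y $$ (i, j))"

definition frob_norm :: "real mat \<Rightarrow> real" where
  "frob_norm X = sqrt (\<Sum>i < dim_row X. \<Sum>j < dim_col X. (X $$ (i, j))\<^sup>2)"

definition is_projected_gradient :: "real mat \<Rightarrow> (real mat \<Rightarrow> bool) \<Rightarrow> real mat \<Rightarrow> bool" where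
  "is_projected_gradient g C D \<longleftrightarrow>
     is_arg_min (\<lambda>E. 1/2 * (frob_norm (g - E))\<^sup>2)
       (\<lambda>E. E \<in> carrier_mat (dim_row g) (dim_col g) \<and> C E) D"

definition lagrangian ::
  "real mat \<Rightarrow> nat \<Rightarrow> (nat \<Rightarrow> real mat) \<Rightarrow> (nat \<Rightarrow> real mat) \<Rightarrow> (nat \<Rightarrow> real mat) \<Rightarrow> real mat \<Rightarrow> real" where
  "lagrangian g N G H \<Lambda> D =
     1/2 * (frob_norm (g - D))\<^sup>2 + (\<Sum>i=1..N. frob_inner (\<Lambda> i) (G i * D * H i))"

definition lagrange_multipliers ::
  "real mat \<Rightarrow> nat \<Rightarrow> (nat \<Rightarrow> real mat) \<Rightarrow> (nat \<Rightarrow> real mat) \<Rightarrow> real mat \<Rightarrow> (nat \<Rightarrow> real mat) \<Rightarrow> bool" where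
  "lagrange_multipliers g N G H D \<Lambda> \<longleftrightarrow>
     (\<forall>i \<in> {1..N}. \<Lambda> i \<in> carrier_mat (dim_row (G i)) (dim_col (H i))) \<and>
     has_matrix_gradient (lagrangian g N G H \<Lambda>) D (0\<^sub>m (dim_row g) (dim_col g))"

definition solves_multiplier_system ::
  "real mat \<Rightarrow> nat \<Rightarrow> (nat \<Rightarrow> real mat) \<Rightarrow> (nat \<Rightarrow> real mat) \<Rightarrow> (nat \<Rightarrow> real mat) \<Rightarrow> bool" where
  "solves_multiplier_system g N G H \<Lambda> \<longleftrightarrow>
     (\<forall>i \<in> {1..N}. \<Lambda> i \<in> carrier_mat (dim_row (G i)) (dim_col (H i))) \<and>
     (\<forall>l \<in> {1..N}. G l * g * H l =
        mat_sum (dim_row (G l)) (dim_col (H l))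
          (\<lambda>i. G l * (G i)\<^sup>T * \<Lambda> i * (H i)\<^sup>T * H l) {1..N})"

end

theory Submission
  imports Defs
begin

text \<open>The map \<open>L \<mapsto> G\<^sup>T L H\<^sup>T\<close> is adjoint to \<open>D \<mapsto> G D H\<close> for the Frobenius inner product, so every
  \<open>S = \<Sum>\<^sub>i G\<^sub>i\<^sup>T \<Lambda>\<^sub>i H\<^sub>i\<^sup>T\<close> is orthogonal to all feasible matrices. If moreover \<open>g - S\<close> is feasible, which is
  exactly the multiplier system, then by Pythagoras \<open>g - S\<close> is the unique minimiser. The system is
  the system of normal equations for the projection of \<open>g\<close> onto the space of these \<open>S\<close>, hence
  solvable; for a single constraint, the Gram matrices are inverted to solve it. The gradient of the Lagrangian at \<open>D\<close> is \<open>S - (g - D)\<close>.\<close>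

section \<open>The Frobenius inner product\<close>

lemma frob_norm_square: "(frob_norm X)\<^sup>2 = frob_inner X X"
proof -
  have "0 \<le> (\<Sum>i < dim_row X. \<Sum>j < dim_col X. (X $$ (i, j))\<^sup>2)"
    by (intro sum_nonneg) auto
  then show ?thesis
    by (simp add: frob_norm_def frob_inner_def power2_eq_square)
qed

lemma frob_inner_comm:
  assumes "X \<in> carrier_mat m n" "Y \<in> carrier_mat m n"
  shows "frob_inner X Y = frob_inner Y X"
  using assms by (simp add: frob_inner_def mult.commute)

lemma frob_inner_add_left:
  assumes "X \<in> carrier_mat m n" "Y \<in> carrier_mat m n"
  shows "frob_inner (X + Y) Z = frob_inner X Z + frob_inner Y Z"
  using assms by (simp add: frob_inner_def distrib_right sum.distrib)

lemma frob_inner_minus_left: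
  assumes "X \<in> carrier_mat m n" "Y \<in> carrier_mat m n"
  shows "frob_inner (X - Y) Z = frob_inner X Z - frob_inner Y Z"
  using assms by (simp add: frob_inner_def left_diff_distrib sum_subtractf)

lemma frob_inner_add_right:
  assumes "X \<in> carrier_mat m n" "Y \<in> carrier_mat m n" "Z \<in> carrier_mat m n"
  shows "frob_inner X (Y + Z) = frob_inner X Y + frob_inner X Z"
  using assms by (simp add: frob_inner_def distrib_left sum.distrib)

lemma frob_inner_smult_right:
  assumes "X \<in> carrier_mat m n" "Y \<in> carrier_mat m n"
  shows "frob_inner X (c \<cdot>\<^sub>m Y) = c * frob_inner X Y"
  using assms by (simp add: frob_inner_def sum_distrib_left mult_ac)

lemma frob_inner_zero_left: "frob_inner (0\<^sub>m m n) Y = 0"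
  by (simp add: frob_inner_def)

lemma frob_inner_zero_right:
  assumes "X \<in> carrier_mat m n"
  shows "frob_inner X (0\<^sub>m m n) = 0"
  using assms by (simp add: frob_inner_def)

lemma frob_inner_self_nonneg: "0 \<le> frob_inner X X"
  by (simp add: frob_inner_def sum_nonneg)

text \<open>Definiteness is what later turns equality of distances into uniqueness of the
  minimiser.\<close>

lemma frob_inner_self_eq_0:
  assumes X: "X \<in> carrier_mat m n" and "frob_inner X X = 0"
  shows "X = 0\<^sub>m m n"
proof (rule eq_matI)
  fix i j assume "i < dim_row (0\<^sub>m m n)" "j < dim_col (0\<^sub>m m n :: real mat)"
  moreover have "(\<Sum>j < n. X $$ (i, j) * X $$ (i, j)) = 0" if "i < m" for i
    using assms that
    by (simp add: frob_inner_def sum_nonneg_eq_0_iff sum_nonneg)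
  ultimately show "X $$ (i, j) = 0\<^sub>m m n $$ (i, j)"
    by (simp add: sum_nonneg_eq_0_iff)
qed (use X in auto)

text \<open>Used to read a partial derivative as the directional derivative along
  \<open>unit_mat\<close>.\<close>

lemma frob_inner_unit_mat:
  assumes "X \<in> carrier_mat m n" "i < m" "j < n"
  shows "frob_inner X (unit_mat m n i j) = X $$ (i, j)"
proof -
  \<comment> \<open>The condition on the pair is split into nested conditionals so that
    \<open>sum.delta\<close> can collapse the sum over \<open>l\<close> and then the one over
    \<open>k\<close>.\<close>
  have "frob_inner X (unit_mat m n i j) =
    (\<Sum>k<m. \<Sum>l<n. if l = j then if k = i then X $$ (k, l) else 0 else 0)"
  proof -
    have "X $$ (k, l) * unit_mat m n i j $$ (k, l) = (if l = j then if k = i then X $$ (k, l) else 0 else 0)"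
      if "k < m" "l < n" for k l using that by (auto simp: unit_mat_def)
    then show ?thesis using assms(1) by (simp add: frob_inner_def)
  qed
  also have "\<dots> = X $$ (i, j)"
    using assms by (simp add: sum.delta)
  finally show ?thesis .
qed

text \<open>Both sides are the same triple sum; three exchanges move the sum over \<open>i\<close>
  from the outermost to the innermost place, where it forms the product with
  \<open>A\<^sup>T\<close>.\<close>

lemma frob_inner_mult_left:
  assumes "X \<in> carrier_mat m n" "A \<in> carrier_mat m p" "Y \<in> carrier_mat p n"
  shows "frob_inner X (A * Y) = frob_inner (A\<^sup>T * X) Y"
proof -
  have "frob_inner X (A * Y) = (\<Sum>i<m. \<Sum>j<n. \<Sum>k<p. X $$ (i, j) * (A $$ (i, k) * Y $$ (k, j)))"
    using assms by (simp add: frob_inner_def scalar_prod_def sum_distrib_left atLeast0LessThan)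
  also have "\<dots> = (\<Sum>i<m. \<Sum>k<p. \<Sum>j<n. X $$ (i, j) * (A $$ (i, k) * Y $$ (k, j)))"
    by (intro sum.cong refl sum.swap)
  also have "\<dots> = (\<Sum>k<p. \<Sum>i<m. \<Sum>j<n. X $$ (i, j) * (A $$ (i, k) * Y $$ (k, j)))"
    by (rule sum.swap)
  also have "\<dots> = (\<Sum>k<p. \<Sum>j<n. \<Sum>i<m. X $$ (i, j) * (A $$ (i, k) * Y $$ (k, j)))"
    by (intro sum.cong refl sum.swap)
  also have "\<dots> = frob_inner (A\<^sup>T * X) Y"
    using assms
    by (simp add: frob_inner_def scalar_prod_def sum_distrib_right sum_distrib_left atLeast0LessThan mult_ac)
  finally show ?thesis .
qed

lemma frob_inner_transpose: "frob_inner X\<^sup>T Y\<^sup>T = frob_inner X Y"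
  if "X \<in> carrier_mat m n" "Y \<in> carrier_mat m n"
  using that by (simp add: frob_inner_def) (rule sum.swap)

text \<open>Transposing both arguments turns the right factor into a left one, which reduces the
  claim to \<open>frob_inner_mult_left\<close>.\<close>

lemma frob_inner_mult_right:
  assumes "X \<in> carrier_mat m n" "Y \<in> carrier_mat m q" "B \<in> carrier_mat q n"
  shows "frob_inner X (Y * B) = frob_inner (X * B\<^sup>T) Y"
proof -
  have "frob_inner X (Y * B) = frob_inner X\<^sup>T (B\<^sup>T * Y\<^sup>T)"
    using assms frob_inner_transpose[of X m n "Y * B"] by (simp add: transpose_mult)
  also have "\<dots> = frob_inner (B * X\<^sup>T) Y\<^sup>T"
    using assms by (subst frob_inner_mult_left) auto
  also have "\<dots> = frob_inner (X * B\<^sup>T)\<^sup>T Y\<^sup>T"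
    using assms by (simp add: transpose_mult)
  also have "\<dots> = frob_inner (X * B\<^sup>T) Y"
    using assms by (intro frob_inner_transpose) auto
  finally show ?thesis .
qed

text \<open>The adjointness behind the orthogonality argument: first \<open>H\<close>, then
  \<open>G\<close> is moved across the inner product.\<close>

lemma frob_inner_sandwich:
  assumes "L \<in> carrier_mat p q" "G \<in> carrier_mat p m" "D \<in> carrier_mat m n" "H \<in> carrier_mat n q"
  shows "frob_inner L (G * D * H) = frob_inner (G\<^sup>T * L * H\<^sup>T) D"
proof -
  have "frob_inner L (G * D * H) = frob_inner (L * H\<^sup>T) (G * D)"
    using assms by (intro frob_inner_mult_right) auto
  also have "\<dots> = frob_inner (G\<^sup>T * (L * H\<^sup>T)) D"
    using assms by (intro frob_inner_mult_left) auto
  finally show ?thesis using assms by (simp add: assoc_mult_mat[where ?n\<^sub>2.0=p and ?n\<^sub>3.0=q])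
qed

section \<open>Finite sums of matrices\<close>

text \<open>A \<open>mat_sum\<close> is a sum in the abelian group \<open>module_mat\<close>. This
  lemma and the next three interpret that group and translate its operations back to
  matrices.\<close>

lemma mat_sum_empty [simp]: "mat_sum r c f {} = 0\<^sub>m r c"
proof -
  interpret abelian_group "module_mat TYPE(real) r c" by (rule abelian_group_mat)
  show ?thesis by (simp add: module_mat_simps)
qed

lemma mat_sum_closed:
  assumes "\<And>i. i \<in> I \<Longrightarrow> f i \<in> carrier_mat r c"
  shows "mat_sum r c f I \<in> carrier_mat r c"
proof -
  interpret abelian_group "module_mat TYPE(real) r c" by (rule abelian_group_mat)
  show ?thesis using finsum_closed[of f I] assms by (auto simp: module_mat_simps)
qed

lemma mat_sum_insert:
  assumes "finite I" "k \<notin> I" "\<And>i. i \<in> insert k I \<Longrightarrow> f i \<in> carrier_mat r c"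
  shows "mat_sum r c f (insert k I) = f k + mat_sum r c f I"
proof -
  interpret abelian_group "module_mat TYPE(real) r c" by (rule abelian_group_mat)
  show ?thesis using finsum_insert[of I k f] assms by (auto simp: module_mat_simps)
qed

lemma mat_sum_cong:
  assumes "\<And>i. i \<in> I \<Longrightarrow> f i = g i" "\<And>i. i \<in> I \<Longrightarrow> g i \<in> carrier_mat r c"
  shows "mat_sum r c f I = mat_sum r c g I"
proof -
  interpret abelian_group "module_mat TYPE(real) r c" by (rule abelian_group_mat)
  show ?thesis using assms by (intro finsum_cong') (auto simp: module_mat_simps)
qed

lemma index_mat_sum:
  assumes "finite I" "\<And>i. i \<in> I \<Longrightarrow> f i \<in> carrier_mat r c" "a < r" "b < c"
  shows "mat_sum r c f I $$ (a, b) = (\<Sum>i\<in>I. f i $$ (a, b))"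
  using assms(1,2)
proof (induction I rule: finite_induct)
  case (insert k I)
  have ins: "mat_sum r c f (insert k I) = f k + mat_sum r c f I"
    using insert.hyps insert.prems by (rule mat_sum_insert)
  have "mat_sum r c f I \<in> carrier_mat r c"
    using insert.prems by (intro mat_sum_closed) auto
  with insert assms(3,4) show ?case
    by (simp add: ins)
qed (use assms(3,4) in simp)

lemma mat_sum_mult_left:
  assumes A: "A \<in> carrier_mat s r" and "finite I" "\<And>i. i \<in> I \<Longrightarrow> f i \<in> carrier_mat r c"
  shows "A * mat_sum r c f I = mat_sum s c (\<lambda>i. A * f i) I"
  using assms(2,3)
proof (induction I rule: finite_induct)
  case (insert k I)
  have ins: "mat_sum r c f (insert k I) = f k + mat_sum r c f I"
    using insert.hyps insert.prems by (rule mat_sum_insert)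
  have "mat_sum r c f I \<in> carrier_mat r c"
    using insert.prems by (intro mat_sum_closed) auto
  moreover have *: "\<And>i. i \<in> insert k I \<Longrightarrow> A * f i \<in> carrier_mat s c"
    using A insert.prems by auto
  moreover have "mat_sum s c (\<lambda>i. A * f i) (insert k I) = A * f k + mat_sum s c (\<lambda>i. A * f i) I"
    using insert.hyps * by (rule mat_sum_insert)
  ultimately show ?case
    using insert.IH insert.prems mult_add_distrib_mat[OF A, of "f k" c "mat_sum r c f I"]
    by (simp add: ins)
qed (use A in simp)

lemma mat_sum_mult_right:
  assumes A: "A \<in> carrier_mat c s" and "finite I" "\<And>i. i \<in> I \<Longrightarrow> f i \<in> carrier_mat r c"
  shows "mat_sum r c f I * A = mat_sum r s (\<lambda>i. f i * A) I"
  using assms(2,3)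
proof (induction I rule: finite_induct)
  case (insert k I)
  have ins: "mat_sum r c f (insert k I) = f k + mat_sum r c f I"
    using insert.hyps insert.prems by (rule mat_sum_insert)
  have "mat_sum r c f I \<in> carrier_mat r c"
    using insert.prems by (intro mat_sum_closed) auto
  moreover have *: "\<And>i. i \<in> insert k I \<Longrightarrow> f i * A \<in> carrier_mat r s"
    using A insert.prems mult_carrier_mat by blast
  moreover have "mat_sum r s (\<lambda>i. f i * A) (insert k I) = f k * A + mat_sum r s (\<lambda>i. f i * A) I"
    using insert.hyps * by (rule mat_sum_insert)
  ultimately show ?case
    using insert.IH insert.prems add_mult_distrib_mat[of "f k" r c "mat_sum r c f I" A s] A
    by (simp add: ins)
qed (use A in simp)

lemma frob_inner_mat_sum_left:
  assumes "finite I" "\<And>i. i \<in> I \<Longrightarrow> f i \<in> carrier_mat r c"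
  shows "frob_inner (mat_sum r c f I) Y = (\<Sum>i\<in>I. frob_inner (f i) Y)"
  using assms
proof (induction I rule: finite_induct)
  case (insert k I)
  have ins: "mat_sum r c f (insert k I) = f k + mat_sum r c f I"
    using insert.hyps insert.prems by (rule mat_sum_insert)
  have "mat_sum r c f I \<in> carrier_mat r c"
    using insert.prems by (intro mat_sum_closed) auto
  with insert show ?case
    by (simp add: ins frob_inner_add_left[where m=r and n=c])
qed (simp add: frob_inner_zero_left)

section \<open>Full rank and Gram matrices\<close>

text \<open>If \<open>A\<^sup>T * A\<close> kills \<open>v\<close>, then
  \<open>A *\<^sub>v v\<close> has inner product 0 with itself, so it vanishes and injectivity gives
  \<open>v = 0\<close>. Over a field a trivial kernel means a nonzero determinant.\<close>

lemma gram_invertible: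
  fixes A :: "real mat"
  assumes A: "A \<in> carrier_mat r c"
    and inj: "\<And>v. v \<in> carrier_vec c \<Longrightarrow> A *\<^sub>v v = 0\<^sub>v r \<Longrightarrow> v = 0\<^sub>v c"
  shows "det (A\<^sup>T * A) \<noteq> 0"
proof
  assume "det (A\<^sup>T * A) = 0"
  moreover have "A\<^sup>T * A \<in> carrier_mat c c" using A by simp
  ultimately obtain v where v: "v \<in> carrier_vec c" "v \<noteq> 0\<^sub>v c" "(A\<^sup>T * A) *\<^sub>v v = 0\<^sub>v c"
    using det_0_iff_vec_prod_zero_field by blast
  have Av: "A *\<^sub>v v \<in> carrier_vec r" using A v by simp
  have "(A *\<^sub>v v) \<bullet> (A *\<^sub>v v) = (A\<^sup>T *\<^sub>v (A *\<^sub>v v)) \<bullet> v"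
    using transpose_vec_mult_scalar[OF A v(1) Av] by simp
  also have "A\<^sup>T *\<^sub>v (A *\<^sub>v v) = 0\<^sub>v c"
    using assoc_mult_mat_vec[of "A\<^sup>T" c r A c v] A v by simp
  also have "0\<^sub>v c \<bullet> v = 0" using v(1) by simp
  \<comment> \<open>Conjugation is the identity on real vectors, so definiteness of the conjugate
    scalar product applies.\<close>
  finally have "A *\<^sub>v v = 0\<^sub>v r"
    using conjugate_square_eq_0_vec[OF Av] by (simp add: conjugate_vec_def)
  with inj v show False by blast
qed

text \<open>Full row rank makes the columns span the whole space, so
  \<open>v = G *\<^sub>v w\<close> for some \<open>w\<close>; then \<open>v \<bullet> v\<close>
  equals \<open>(G\<^sup>T *\<^sub>v v) \<bullet> w\<close>, which is 0.\<close>

lemma full_row_rank_transpose_injective: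
  assumes G: "G \<in> carrier_mat p m" and "full_row_rank G"
    and v: "v \<in> carrier_vec p" and 0: "G\<^sup>T *\<^sub>v v = 0\<^sub>v m"
  shows "v = 0\<^sub>v p"
proof -
  interpret vec_space "TYPE(real)" p .
  have rank: "rank G = p" using assms by (simp add: full_row_rank_def)
  \<comment> \<open>The rank is the size of a maximal independent set of columns; having
    \<open>p\<close> elements in dimension \<open>p\<close>, this set is a basis.\<close>
  obtain S where S: "maximal S (\<lambda>T. T \<subseteq> set (cols G) \<and> lin_indpt T)"
    using maximal_exists_superset[of "set (cols G)" "\<lambda>T. T \<subseteq> set (cols G) \<and> lin_indpt T" "{}"]
    by (auto simp: lin_dep_def)
  have sub: "S \<subseteq> set (cols G)" "lin_indpt S" using S by (auto simp: maximal_def)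
  have cols: "set (cols G) \<subseteq> carrier_vec p" using G cols_dim by blast
  have "card S = p" using rank_card_indpt[OF G S] rank by simp
  then have "basis S"
    using sub cols finite_subset[OF sub(1)]
    by (intro dim_li_is_basis) (auto simp: dim_is_n fin_dim)
  then have "span S = carrier_vec p" by (simp add: basis_def)
  then have "carrier_vec p \<subseteq> span (set (cols G))" using span_is_monotone[OF sub(1)] by simp
  then have "v \<in> col_space G" using v by (auto simp: col_space_def)
  then obtain w where w: "w \<in> carrier_vec m" "G *\<^sub>v w = v"
    using col_space_eq[OF G] G by auto
  have "v \<bullet> v = 0"
    using transpose_vec_mult_scalar[OF G w(1) v] w 0 by simp
  then show ?thesis
    using conjugate_square_eq_0_vec[OF v] by (simp add: conjugate_vec_def)
qed

text \<open>Full column rank makes the columns independent, and a nonzero kernel vector would be a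
  linear dependency among them.\<close>

lemma full_col_rank_injective:
  assumes H: "H \<in> carrier_mat n q" and "full_col_rank H"
    and v: "v \<in> carrier_vec q" and 0: "H *\<^sub>v v = 0\<^sub>v n"
  shows "v = 0\<^sub>v q"
proof -
  interpret vec_space "TYPE(real)" n .
  have rank: "rank H = q" using assms by (simp add: full_col_rank_def)
  obtain S where S: "maximal S (\<lambda>T. T \<subseteq> set (cols H) \<and> lin_indpt T)"
    using maximal_exists_superset[of "set (cols H)" "\<lambda>T. T \<subseteq> set (cols H) \<and> lin_indpt T" "{}"]
    by (auto simp: lin_dep_def)
  \<comment> \<open>Independence concerns the set of columns, so repetitions must be excluded first:
    the list has \<open>q\<close> entries and at least \<open>q\<close> different ones.\<close>
  have "q \<le> card (set (cols H))"
    using rank_card_indpt[OF H S] rank S by (auto simp: maximal_def intro: card_mono)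
  moreover have "length (cols H) = q" using H by simp
  ultimately have dist: "distinct (cols H)"
    using card_length[of "cols H"] by (intro card_distinct) auto
  show ?thesis
    using lin_depI[OF H v _ 0 dist] full_rank_lin_indpt[OF H rank dist] by blast
qed

text \<open>A nonzero determinant rules out the result \<open>None\<close>, so \<open>the\<close> in
  \<open>mat_inv\<close> yields a genuine inverse.\<close>

lemma mat_inv_det_nonzero:
  fixes M :: "real mat"
  assumes M: "M \<in> carrier_mat k k" and "det M \<noteq> 0"
  shows "mat_inv M \<in> carrier_mat k k" "M * mat_inv M = 1\<^sub>m k" "mat_inv M * M = 1\<^sub>m k"
    "invertible_mat M"
proof -
  \<comment> \<open>Here \<open>undefined\<close> fills the extension slot of the record
    \<open>ring_mat\<close>, on which being a unit does not depend.\<close>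
  have "mat_inverse M \<noteq> None"
    using mat_inverse(1)[OF M, of undefined] det_non_zero_imp_unit[OF M assms(2), of undefined] by auto
  then obtain B where "mat_inverse M = Some B" by blast
  with mat_inverse(2)[OF M this]
  show *: "mat_inv M \<in> carrier_mat k k" "M * mat_inv M = 1\<^sub>m k" "mat_inv M * M = 1\<^sub>m k" by auto
  show "invertible_mat M"
    using * M unfolding invertible_mat_def inverts_mat_def by auto
qed

section \<open>Orthogonal projection\<close>

lemma minus_mat_eq_0_iff:
  fixes X Y :: "real mat"
  assumes "X \<in> carrier_mat m n" "Y \<in> carrier_mat m n"
  shows "X - Y = 0\<^sub>m m n \<longleftrightarrow> X = Y"
proof
  assume eq: "X - Y = 0\<^sub>m m n"
  show "X = Y"
  proof (rule eq_matI)
    fix i j assume "i < dim_row Y" "j < dim_col Y"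
    then show "X $$ (i, j) = Y $$ (i, j)"
      using arg_cong[OF eq, of "\<lambda>M. M $$ (i, j)"] assms by simp
  qed (use assms in auto)
qed (use assms in auto)

text \<open>For feasible \<open>E\<close>, the difference \<open>D - E\<close> is feasible and hence
  orthogonal to \<open>g - D\<close>, so the squared distance from \<open>g\<close> to
  \<open>E\<close> exceeds that to \<open>D\<close> by the square of the norm of
  \<open>D - E\<close>. The predicate \<open>C\<close> is kept abstract to cover one constraint as
  well as several.\<close>

lemma projected_gradient_iff:
  assumes g: "g \<in> carrier_mat m n" and D: "D \<in> carrier_mat m n" "C D"
    and diff: "\<And>E. E \<in> carrier_mat m n \<Longrightarrow> C E \<Longrightarrow> C (D - E)"
    and orth: "\<And>F. F \<in> carrier_mat m n \<Longrightarrow> C F \<Longrightarrow> frob_inner (g - D) F = 0"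
  shows "is_projected_gradient g C D' \<longleftrightarrow> D' = D"
proof -
  have pyth: "(frob_norm (g - E))\<^sup>2 = (frob_norm (g - D))\<^sup>2 + frob_inner (D - E) (D - E)"
    if E: "E \<in> carrier_mat m n" "C E" for E
  proof -
    have gE: "g - E = (g - D) + (D - E)" using g D E by (intro eq_matI) auto
    have car: "g - D \<in> carrier_mat m n" "D - E \<in> carrier_mat m n" using g D E by auto
    have "frob_inner (g - D) (D - E) = 0" using orth diff car E by blast
    then show ?thesis unfolding frob_norm_square gE
      using car frob_inner_comm[OF car]
      by (simp add: frob_inner_add_left[where m=m and n=n] frob_inner_add_right[where m=m and n=n])
  qed
  show ?thesis
  proof
    assume L: "is_projected_gradient g C D'"
    then have D': "D' \<in> carrier_mat m n" "C D'"
      using g by (auto simp: is_projected_gradient_def is_arg_min_def)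
    \<comment> \<open>\<open>is_arg_min\<close> forbids a strictly smaller value at
      \<open>D\<close>; together with \<open>pyth\<close> at \<open>D'\<close> this squeezes the
      excess to 0.\<close>
    have "\<not> (frob_norm (g - D))\<^sup>2 < (frob_norm (g - D'))\<^sup>2"
      using L g D by (auto simp: is_projected_gradient_def is_arg_min_def)
    then have "frob_inner (D - D') (D - D') = 0"
      using pyth[OF D'] frob_inner_self_nonneg[of "D - D'"] by linarith
    then have "D - D' = 0\<^sub>m m n"
      using D D' by (intro frob_inner_self_eq_0) auto
    then show "D' = D"
      using minus_mat_eq_0_iff[OF D(1) D'(1)] by simp
  next
    assume "D' = D"
    moreover have "\<not> (frob_norm (g - E))\<^sup>2 < (frob_norm (g - D))\<^sup>2"
      if "E \<in> carrier_mat m n" "C E" for E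
      using pyth[OF that] frob_inner_self_nonneg[of "D - E"] by linarith
    ultimately show "is_projected_gradient g C D'"
      using D g by (auto simp: is_projected_gradient_def is_arg_min_def)
  qed
qed

text \<open>Gram--Schmidt: the new vector \<open>v k\<close> is replaced by its residual \<open>w\<close>.
  If \<open>w = 0\<close>, the coefficient \<open>t\<close> is \<open>0/0 = 0\<close>.\<close>

lemma normal_equations_solvable:
  fixes v :: "'j \<Rightarrow> 'x \<Rightarrow> real"
  assumes "finite J" and I: "finite I"
  shows "\<exists>c. \<forall>l\<in>J. (\<Sum>x\<in>I. (g x - (\<Sum>j\<in>J. c j * v j x)) * v l x) = 0"
  using assms(1)
proof (induction J arbitrary: g rule: finite_induct)
  case (insert k J)
  \<comment> \<open>The induction hypothesis is used twice, here for \<open>g\<close> and next for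
    \<open>v k\<close> as the function to be projected; this is why \<open>g\<close> is
    generalised.\<close>
  obtain a where a: "\<And>l. l \<in> J \<Longrightarrow> (\<Sum>x\<in>I. (g x - (\<Sum>j\<in>J. a j * v j x)) * v l x) = 0"
    using insert.IH by blast
  obtain b where b: "\<And>l. l \<in> J \<Longrightarrow> (\<Sum>x\<in>I. (v k x - (\<Sum>j\<in>J. b j * v j x)) * v l x) = 0"
    using insert.IH by blast
  define r where "r x = g x - (\<Sum>j\<in>J. a j * v j x)" for x
  define w where "w x = v k x - (\<Sum>j\<in>J. b j * v j x)" for x
  define t where "t = (\<Sum>x\<in>I. r x * w x) / (\<Sum>x\<in>I. w x * w x)"
  \<comment> \<open>These coefficients re-expand the combination subtracted from \<open>g\<close> in
    terms of the \<open>v j\<close>, after \<open>w\<close> is replaced by its definition.\<close>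
  define c where "c j = (if j = k then t else a j - t * b j)" for j
  have res: "g x - (\<Sum>j\<in>insert k J. c j * v j x) = r x - t * w x" for x
  proof -
    have "(\<Sum>j\<in>J. c j * v j x) = (\<Sum>j\<in>J. a j * v j x - t * (b j * v j x))"
      using insert.hyps by (intro sum.cong) (auto simp: c_def algebra_simps)
    then show ?thesis using insert.hyps
      by (simp add: c_def r_def w_def sum_subtractf sum_distrib_left algebra_simps)
  qed
  have J: "(\<Sum>x\<in>I. (r x - t * w x) * v l x) = 0" if "l \<in> J" for l
  proof -
    have "(\<Sum>x\<in>I. (r x - t * w x) * v l x) = (\<Sum>x\<in>I. r x * v l x) - t * (\<Sum>x\<in>I. w x * v l x)"
      by (simp add: sum_subtractf sum_distrib_left left_diff_distrib mult.assoc)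
    then show ?thesis using a[OF that] b[OF that] by (simp add: r_def w_def)
  qed
  have "(\<Sum>x\<in>I. (r x - t * w x) * w x) = (\<Sum>x\<in>I. r x * w x) - t * (\<Sum>x\<in>I. w x * w x)"
    by (simp add: sum_subtractf sum_distrib_left left_diff_distrib mult.assoc)
  also have "\<dots> = 0"
  proof (cases "(\<Sum>x\<in>I. w x * w x) = 0")
    case True
    then have "\<forall>x\<in>I. w x = 0" using I by (simp add: sum_nonneg_eq_0_iff)
    then show ?thesis by simp
  qed (simp add: t_def)
  finally have w: "(\<Sum>x\<in>I. (r x - t * w x) * w x) = 0" .
  \<comment> \<open>Since \<open>v k\<close> is \<open>w\<close> plus a combination of the old
    vectors, orthogonality to \<open>w\<close> and to those vectors yields orthogonality to
    \<open>v k\<close>.\<close>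
  have "(\<Sum>x\<in>I. (r x - t * w x) * v k x)
      = (\<Sum>x\<in>I. (r x - t * w x) * w x + (\<Sum>j\<in>J. b j * ((r x - t * w x) * v j x)))"
  proof (rule sum.cong[OF refl])
    fix x
    have "v k x = w x + (\<Sum>j\<in>J. b j * v j x)" by (simp add: w_def)
    then have "(r x - t * w x) * v k x
        = (r x - t * w x) * w x + (r x - t * w x) * (\<Sum>j\<in>J. b j * v j x)"
      by (simp only: distrib_left)
    then show "(r x - t * w x) * v k x
        = (r x - t * w x) * w x + (\<Sum>j\<in>J. b j * ((r x - t * w x) * v j x))"
      by (simp add: sum_distrib_left mult.left_commute)
  qed
  also have "\<dots> = (\<Sum>j\<in>J. \<Sum>x\<in>I. b j * ((r x - t * w x) * v j x))"
    using w by (subst sum.swap) (simp add: sum.distrib)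
  also have "\<dots> = 0"
    using J by (simp add: sum_distrib_left[symmetric])
  finally have "(\<Sum>x\<in>I. (r x - t * w x) * v k x) = 0" .
  with J show ?case by (intro exI[of _ c]) (simp only: res, blast)
qed simp

section \<open>Entries and differences of products \<open>A * X * B\<close>\<close>

lemma index_sandwich:
  fixes A X B :: "real mat"
  assumes "A \<in> carrier_mat p m" "X \<in> carrier_mat m n" "B \<in> carrier_mat n q" "a < p" "b < q"
  shows "(A * X * B) $$ (a, b) = (\<Sum>k<m. \<Sum>l<n. A $$ (a, k) * X $$ (k, l) * B $$ (l, b))"
proof -
  have "(A * X * B) $$ (a, b) = (\<Sum>l<n. \<Sum>k<m. A $$ (a, k) * X $$ (k, l) * B $$ (l, b))"
    using assms
    by (simp del: assoc_mult_mat add: scalar_prod_def sum_distrib_right atLeast0LessThan)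
  then show ?thesis by (rule trans[OF _ sum.swap])
qed

lemma sandwich_minus:
  fixes A X Y B :: "real mat"
  assumes "A \<in> carrier_mat p m" "X \<in> carrier_mat m n" "Y \<in> carrier_mat m n" "B \<in> carrier_mat n q"
  shows "A * (X - Y) * B = A * X * B - A * Y * B"
proof -
  have "A * X \<in> carrier_mat p n" "A * Y \<in> carrier_mat p n" using assms by auto
  then show ?thesis
    using mult_minus_distrib_mat[OF assms(1-3)] minus_mult_distrib_mat[OF _ _ assms(4), of "A * X" p "A * Y"]
    by simp
qed

section \<open>Several constraints\<close>

locale constraint_family =
  fixes m n N :: nat and p q :: "nat \<Rightarrow> nat" and G H :: "nat \<Rightarrow> real mat"
  assumes G: "\<And>i. i \<in> {1..N} \<Longrightarrow> G i \<in> carrier_mat (p i) m"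
    and H: "\<And>i. i \<in> {1..N} \<Longrightarrow> H i \<in> carrier_mat n (q i)"
begin

definition multipliers :: "(nat \<Rightarrow> real mat) \<Rightarrow> bool" where
  "multipliers \<Lambda> \<longleftrightarrow> (\<forall>i \<in> {1..N}. \<Lambda> i \<in> carrier_mat (p i) (q i))"

text \<open>Links the shapes named by the locale with the dimensions read off \<open>G i\<close> and
  \<open>H i\<close> in the definitions.\<close>

lemma multipliers_iff_dims:
  "multipliers \<Lambda> \<longleftrightarrow> (\<forall>i \<in> {1..N}. \<Lambda> i \<in> carrier_mat (dim_row (G i)) (dim_col (H i)))"
  unfolding multipliers_def
proof (rule ball_cong[OF refl])
  fix i assume "i \<in> {1..N}"
  then show "\<Lambda> i \<in> carrier_mat (p i) (q i) \<longleftrightarrow> \<Lambda> i \<in> carrier_mat (dim_row (G i)) (dim_col (H i))"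
    using carrier_matD(1)[OF G] carrier_matD(2)[OF H] by simp
qed

definition feasible :: "real mat \<Rightarrow> bool" where
  "feasible E \<longleftrightarrow> (\<forall>i \<in> {1..N}. G i * E * H i = 0\<^sub>m (p i) (q i))"

text \<open>The matrix \<open>S\<close> of the overview, a normal vector to the feasible subspace:
  the adjoint of the joint constraint map applied to the multipliers.\<close>

definition normal_part :: "(nat \<Rightarrow> real mat) \<Rightarrow> real mat" where
  "normal_part \<Lambda> = mat_sum m n (\<lambda>i. (G i)\<^sup>T * \<Lambda> i * (H i)\<^sup>T) {1..N}"

lemma sandwich_closed:
  assumes "multipliers \<Lambda>" "i \<in> {1..N}"
  shows "(G i)\<^sup>T * \<Lambda> i * (H i)\<^sup>T \<in> carrier_mat m n"
  using assms G[OF assms(2)] H[OF assms(2)] by auto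

lemma normal_part_closed: "multipliers \<Lambda> \<Longrightarrow> normal_part \<Lambda> \<in> carrier_mat m n"
  unfolding normal_part_def by (intro mat_sum_closed sandwich_closed)

lemma frob_inner_normal_part:
  assumes "multipliers \<Lambda>" "D \<in> carrier_mat m n"
  shows "frob_inner (normal_part \<Lambda>) D = (\<Sum>i=1..N. frob_inner (\<Lambda> i) (G i * D * H i))"
proof -
  have "frob_inner (normal_part \<Lambda>) D = (\<Sum>i=1..N. frob_inner ((G i)\<^sup>T * \<Lambda> i * (H i)\<^sup>T) D)"
    unfolding normal_part_def using sandwich_closed[OF assms(1)]
    by (intro frob_inner_mat_sum_left) auto
  also have "\<dots> = (\<Sum>i=1..N. frob_inner (\<Lambda> i) (G i * D * H i))"
  proof (rule sum.cong[OF refl])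
    fix i assume i: "i \<in> {1..N}"
    then have "\<Lambda> i \<in> carrier_mat (p i) (q i)" using assms(1) by (simp add: multipliers_def)
    then show "frob_inner ((G i)\<^sup>T * \<Lambda> i * (H i)\<^sup>T) D = frob_inner (\<Lambda> i) (G i * D * H i)"
      using frob_inner_sandwich[OF _ G[OF i] assms(2) H[OF i]] by simp
  qed
  finally show ?thesis .
qed

lemma feasible_diff:
  assumes "feasible D" "feasible E" "D \<in> carrier_mat m n" "E \<in> carrier_mat m n"
  shows "feasible (D - E)"
  unfolding feasible_def
proof
  fix i assume i: "i \<in> {1..N}"
  have "G i * (D - E) * H i = G i * D * H i - G i * E * H i"
    using G[OF i] assms(3,4) H[OF i] by (rule sandwich_minus)
  then show "G i * (D - E) * H i = 0\<^sub>m (p i) (q i)"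
    using assms i by (simp add: feasible_def)
qed

text \<open>By linearity \<open>G l\<close> and \<open>H l\<close> can be taken out of the sum, so
  the right side of equation \<open>l\<close> is \<open>G l * normal_part \<Lambda> * H l\<close>.
  The equation then says that the residual satisfies constraint \<open>l\<close>.\<close>

lemma solves_multiplier_system_iff:
  assumes g: "g \<in> carrier_mat m n"
  shows "solves_multiplier_system g N G H \<Lambda> \<longleftrightarrow> multipliers \<Lambda> \<and> feasible (g - normal_part \<Lambda>)"
proof (cases "multipliers \<Lambda>")
  case True
  have "G l * g * H l = mat_sum (dim_row (G l)) (dim_col (H l))
          (\<lambda>i. G l * (G i)\<^sup>T * \<Lambda> i * (H i)\<^sup>T * H l) {1..N}
      \<longleftrightarrow> G l * (g - normal_part \<Lambda>) * H l = 0\<^sub>m (p l) (q l)" (is "?GgH = ?S \<longleftrightarrow> _") if l: "l \<in> {1..N}" for l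
  proof -
    note Gl = G[OF l] and Hl = H[OF l]
    have dims: "dim_row (G l) = p l" "dim_col (H l) = q l" using Gl Hl by auto
    have "?S = mat_sum (p l) (q l) (\<lambda>i. G l * ((G i)\<^sup>T * \<Lambda> i * (H i)\<^sup>T) * H l) {1..N}"
      unfolding dims
    proof (rule mat_sum_cong)
      fix i assume i: "i \<in> {1..N}"
      have L: "\<Lambda> i \<in> carrier_mat (p i) (q i)" using True i by (simp add: multipliers_def)
      have "G l * ((G i)\<^sup>T * \<Lambda> i * (H i)\<^sup>T) = G l * ((G i)\<^sup>T * \<Lambda> i) * (H i)\<^sup>T"
        using Gl G[OF i] H[OF i] L by (intro assoc_mult_mat[symmetric]) auto
      also have "G l * ((G i)\<^sup>T * \<Lambda> i) = G l * (G i)\<^sup>T * \<Lambda> i"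
        using Gl G[OF i] H[OF i] L by (intro assoc_mult_mat[symmetric]) auto
      finally show "G l * (G i)\<^sup>T * \<Lambda> i * (H i)\<^sup>T * H l = G l * ((G i)\<^sup>T * \<Lambda> i * (H i)\<^sup>T) * H l"
        by simp
      show "G l * ((G i)\<^sup>T * \<Lambda> i * (H i)\<^sup>T) * H l \<in> carrier_mat (p l) (q l)"
        using Gl Hl sandwich_closed[OF True i] by auto
    qed
    also have "\<dots> = mat_sum (p l) n (\<lambda>i. G l * ((G i)\<^sup>T * \<Lambda> i * (H i)\<^sup>T)) {1..N} * H l"
      using Gl sandwich_closed[OF True]
      by (intro mat_sum_mult_right[OF Hl, symmetric]) (auto intro: mult_carrier_mat)
    also have "\<dots> = G l * normal_part \<Lambda> * H l"
      unfolding normal_part_def using sandwich_closed[OF True]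
      by (subst mat_sum_mult_left[OF Gl]) auto
    finally have S: "?S = G l * normal_part \<Lambda> * H l" .
    have *: "G l * (g - normal_part \<Lambda>) * H l = G l * g * H l - G l * normal_part \<Lambda> * H l"
      using Gl g normal_part_closed[OF True] Hl by (rule sandwich_minus)
    have car: "G l * g * H l \<in> carrier_mat (p l) (q l)" "G l * normal_part \<Lambda> * H l \<in> carrier_mat (p l) (q l)"
      using Gl Hl g normal_part_closed[OF True] by auto
    show ?thesis unfolding S * using minus_mat_eq_0_iff[OF car] by simp
  qed
  then show ?thesis using True
    unfolding solves_multiplier_system_def feasible_def multipliers_iff_dims by blast
next
  case False
  then show ?thesis
    unfolding solves_multiplier_system_def multipliers_iff_dims by blast
qed

text \<open>Flattening the matrices to real functions of index pairs turns the system into the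
  normal equations already solved.\<close>

lemma multiplier_system_solvable:
  assumes g: "g \<in> carrier_mat m n"
  shows "\<exists>\<Lambda>. solves_multiplier_system g N G H \<Lambda>"
proof -
  define J where "J = (SIGMA i:{1..N}. {..<p i} \<times> {..<q i})"
  \<comment> \<open>As a matrix in \<open>x\<close>, this is the outer product of row
    \<open>a\<close> of \<open>G i\<close> and column \<open>b\<close> of \<open>H i\<close>.
    Pairing it with \<open>D\<close> gives entry \<open>(a, b)\<close> of
    \<open>G i * D * H i\<close>.\<close>
  define v where "v j x = (case j of (i, a, b) \<Rightarrow> case x of (k, l) \<Rightarrow> G i $$ (a, k) * H i $$ (l, b))"
    for j :: "nat \<times> nat \<times> nat" and x :: "nat \<times> nat"
  obtain c where c: "\<And>l. l \<in> J \<Longrightarrow>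
      (\<Sum>x\<in>{..<m} \<times> {..<n}. (g $$ x - (\<Sum>j\<in>J. c j * v j x)) * v l x) = 0"
    using normal_equations_solvable[of J "{..<m} \<times> {..<n}" "\<lambda>x. g $$ x" v] by (auto simp: J_def)
  \<comment> \<open>The coefficients are regrouped into one matrix per constraint, so that
    \<open>normal_part \<Lambda>\<close> is the combination of the \<open>v j\<close> with
    coefficients \<open>c j\<close>.\<close>
  define \<Lambda> where "\<Lambda> i = mat (p i) (q i) (\<lambda>(a, b). c (i, a, b))" for i
  have L: "multipliers \<Lambda>" by (simp add: multipliers_def \<Lambda>_def)
  have np: "normal_part \<Lambda> $$ (k, l) = (\<Sum>j\<in>J. c j * v j (k, l))" if kl: "k < m" "l < n" for k l
  proof -
    have "normal_part \<Lambda> $$ (k, l) = (\<Sum>i=1..N. ((G i)\<^sup>T * \<Lambda> i * (H i)\<^sup>T) $$ (k, l))"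
      unfolding normal_part_def using kl sandwich_closed[OF L] by (intro index_mat_sum) auto
    also have "\<dots> = (\<Sum>i=1..N. \<Sum>ab\<in>{..<p i} \<times> {..<q i}. c (i, ab) * v (i, ab) (k, l))"
    proof (rule sum.cong[OF refl])
      fix i assume i: "i \<in> {1..N}"
      have "((G i)\<^sup>T * \<Lambda> i * (H i)\<^sup>T) $$ (k, l)
        = (\<Sum>a<p i. \<Sum>b<q i. (G i)\<^sup>T $$ (k, a) * \<Lambda> i $$ (a, b) * (H i)\<^sup>T $$ (b, l))"
        using G[OF i] H[OF i] kl by (intro index_sandwich) (auto simp: \<Lambda>_def)
      also have "\<dots> = (\<Sum>a<p i. \<Sum>b<q i. c (i, a, b) * v (i, a, b) (k, l))"
        using G[OF i] H[OF i] kl by (intro sum.cong refl) (auto simp: \<Lambda>_def v_def)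
      finally show "((G i)\<^sup>T * \<Lambda> i * (H i)\<^sup>T) $$ (k, l)
        = (\<Sum>ab\<in>{..<p i} \<times> {..<q i}. c (i, ab) * v (i, ab) (k, l))"
        by (simp add: sum.cartesian_product case_prod_unfold)
    qed
    also have "\<dots> = (\<Sum>j\<in>J. c j * v j (k, l))"
      unfolding J_def by (simp add: sum.Sigma case_prod_unfold)
    finally show ?thesis .
  qed
  have "feasible (g - normal_part \<Lambda>)"
    unfolding feasible_def
  proof
    fix i assume i: "i \<in> {1..N}"
    note np_closed = normal_part_closed[OF L]
    show "G i * (g - normal_part \<Lambda>) * H i = 0\<^sub>m (p i) (q i)"
    proof (rule eq_matI)
      fix a b assume "a < dim_row (0\<^sub>m (p i) (q i) :: real mat)" "b < dim_col (0\<^sub>m (p i) (q i) :: real mat)"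
      then have ab: "a < p i" "b < q i" by auto
      then have "(i, a, b) \<in> J" using i by (simp add: J_def)
      have "(G i * (g - normal_part \<Lambda>) * H i) $$ (a, b)
        = (\<Sum>k<m. \<Sum>l<n. G i $$ (a, k) * (g - normal_part \<Lambda>) $$ (k, l) * H i $$ (l, b))"
        using G[OF i] H[OF i] ab g np_closed by (intro index_sandwich) auto
      also have "\<dots> = (\<Sum>k<m. \<Sum>l<n. (g $$ (k, l) - (\<Sum>j\<in>J. c j * v j (k, l))) * v (i, a, b) (k, l))"
        using np_closed g by (intro sum.cong refl) (auto simp: np v_def)
      also have "\<dots> = 0"
        using c[OF \<open>(i, a, b) \<in> J\<close>] by (simp add: sum.cartesian_product case_prod_unfold)
      finally show "(G i * (g - normal_part \<Lambda>) * H i) $$ (a, b) = 0\<^sub>m (p i) (q i) $$ (a, b)"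
        using ab by simp
    qed (use G[OF i] H[OF i] in auto)
  qed
  with L g show ?thesis by (auto simp: solves_multiplier_system_iff)
qed

text \<open>Valid for every solution of the system, so different solutions share the same
  \<open>normal_part\<close>.\<close>

lemma projected_gradient_multipliers:
  assumes g: "g \<in> carrier_mat m n" and "solves_multiplier_system g N G H \<Lambda>"
  shows "is_projected_gradient g feasible D \<longleftrightarrow> D = g - normal_part \<Lambda>"
proof -
  have L: "multipliers \<Lambda>" "feasible (g - normal_part \<Lambda>)"
    using assms by (auto simp: solves_multiplier_system_iff)
  note np = normal_part_closed[OF L(1)]
  have *: "g - (g - normal_part \<Lambda>) = normal_part \<Lambda>" using g np by (intro eq_matI) auto
  show ?thesis
  proof (rule projected_gradient_iff[OF g])
    show "g - normal_part \<Lambda> \<in> carrier_mat m n" using g np by auto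
    fix F assume F: "F \<in> carrier_mat m n" "feasible F"
    show "feasible (g - normal_part \<Lambda> - F)"
      using L(2) F(2) minus_carrier_mat[OF np] F(1) by (rule feasible_diff)
    have "frob_inner (\<Lambda> i) (G i * F * H i) = 0" if "i \<in> {1..N}" for i
      using L F that by (simp add: feasible_def multipliers_def frob_inner_zero_right)
    then show "frob_inner (g - (g - normal_part \<Lambda>)) F = 0"
      unfolding * using L F by (simp add: frob_inner_normal_part)
  qed (use L in auto)
qed

section \<open>Stationary points of the Lagrangian\<close>

lemma lagrangian_eq:
  assumes "multipliers \<Lambda>" "D \<in> carrier_mat m n"
  shows "lagrangian g N G H \<Lambda> D = 1/2 * frob_inner (g - D) (g - D) + frob_inner (normal_part \<Lambda>) D"
  using assms by (simp add: lagrangian_def frob_norm_square frob_inner_normal_part)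

text \<open>Along a line the Lagrangian is a quadratic polynomial in \<open>t\<close>; its linear
  coefficient identifies \<open>normal_part \<Lambda> - (g - D)\<close> as the gradient.\<close>

lemma lagrangian_line:
  assumes g: "g \<in> carrier_mat m n" and L: "multipliers \<Lambda>"
    and D: "D \<in> carrier_mat m n" and U: "U \<in> carrier_mat m n"
  shows "lagrangian g N G H \<Lambda> (D + t \<cdot>\<^sub>m U) = lagrangian g N G H \<Lambda> D
    + t * frob_inner (normal_part \<Lambda> - (g - D)) U + t\<^sup>2 * (1/2 * frob_inner U U)"
proof -
  note np = normal_part_closed[OF L]
  define X where "X = g - D"
  have X: "X \<in> carrier_mat m n" using g D by (auto simp: X_def)
  have tU: "s \<cdot>\<^sub>m U \<in> carrier_mat m n" for s using U by simp
  \<comment> \<open>Writing the difference as a sum with scalar \<open>-t\<close> lets additivity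
    and homogeneity expand the square.\<close>
  have e: "g - (D + t \<cdot>\<^sub>m U) = X + (-t) \<cdot>\<^sub>m U"
    using g D U by (intro eq_matI) (auto simp: X_def)
  have left: "frob_inner (s \<cdot>\<^sub>m U) Y = s * frob_inner U Y" if "Y \<in> carrier_mat m n" for s Y
    using frob_inner_comm[OF tU that] frob_inner_comm[OF U that]
      frob_inner_smult_right[OF that U] by simp
  have "lagrangian g N G H \<Lambda> (D + t \<cdot>\<^sub>m U)
      = 1/2 * frob_inner (X + (-t) \<cdot>\<^sub>m U) (X + (-t) \<cdot>\<^sub>m U) + frob_inner (normal_part \<Lambda>) (D + t \<cdot>\<^sub>m U)"
    using lagrangian_eq[OF L, of "D + t \<cdot>\<^sub>m U"] D U by (simp add: e)
  also have "frob_inner (X + (-t) \<cdot>\<^sub>m U) (X + (-t) \<cdot>\<^sub>m U)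
      = frob_inner X X - 2 * t * frob_inner X U + t\<^sup>2 * frob_inner U U"
    using X tU U frob_inner_comm[OF X U]
    by (simp add: frob_inner_add_left[OF X tU] frob_inner_add_right[where m=m and n=n]
        frob_inner_smult_right[where m=m and n=n] left power2_eq_square algebra_simps)
  also have "frob_inner (normal_part \<Lambda>) (D + t \<cdot>\<^sub>m U)
      = frob_inner (normal_part \<Lambda>) D + t * frob_inner (normal_part \<Lambda>) U"
    using np D U tU by (simp add: frob_inner_add_right[where m=m and n=n]
        frob_inner_smult_right[where m=m and n=n])
  finally show ?thesis
    using lagrangian_eq[OF L D, of g]
    by (simp add: X_def[symmetric] frob_inner_minus_left[OF np X] algebra_simps)
qed

text \<open>Each partial derivative is an entry of \<open>normal_part \<Lambda> - (g - D)\<close>.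
  As derivatives are unique, the gradient is zero exactly if all these entries vanish.\<close>

lemma lagrangian_gradient_zero_iff:
  assumes g: "g \<in> carrier_mat m n" and L: "multipliers \<Lambda>" and D: "D \<in> carrier_mat m n"
  shows "has_matrix_gradient (lagrangian g N G H \<Lambda>) D (0\<^sub>m m n) \<longleftrightarrow> D = g - normal_part \<Lambda>"
proof -
  note np = normal_part_closed[OF L]
  let ?X = "normal_part \<Lambda> - (g - D)"
  have X: "?X \<in> carrier_mat m n" using np g D by auto
  have deriv: "((\<lambda>t. lagrangian g N G H \<Lambda> (D + t \<cdot>\<^sub>m unit_mat m n i j))
      has_real_derivative ?X $$ (i, j)) (at 0)" if ij: "i < m" "j < n" for i j
  proof -
    have U: "unit_mat m n i j \<in> carrier_mat m n" by (simp add: unit_mat_def)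
    show ?thesis
      unfolding lagrangian_line[OF g L D U] frob_inner_unit_mat[OF X ij]
      by (rule derivative_eq_intros refl | simp)+
  qed
  have zero: "((\<lambda>t. lagrangian g N G H \<Lambda> (D + t \<cdot>\<^sub>m unit_mat m n i j))
      has_real_derivative 0\<^sub>m m n $$ (i, j)) (at 0) \<longleftrightarrow> ?X $$ (i, j) = 0" if ij: "i < m" "j < n" for i j
  proof
    show "?X $$ (i, j) = 0" if "((\<lambda>t. lagrangian g N G H \<Lambda> (D + t \<cdot>\<^sub>m unit_mat m n i j))
      has_real_derivative 0\<^sub>m m n $$ (i, j)) (at 0)"
      using DERIV_unique[OF deriv[OF ij] that] ij by simp
    show "((\<lambda>t. lagrangian g N G H \<Lambda> (D + t \<cdot>\<^sub>m unit_mat m n i j))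
      has_real_derivative 0\<^sub>m m n $$ (i, j)) (at 0)" if "?X $$ (i, j) = 0"
      using deriv[OF ij, unfolded that] ij by simp
  qed
  have "has_matrix_gradient (lagrangian g N G H \<Lambda>) D (0\<^sub>m m n)
      \<longleftrightarrow> (\<forall>i<m. \<forall>j<n. ?X $$ (i, j) = 0)"
  proof -
    have "dim_row D = m" "dim_col D = n" using D by auto
    then show ?thesis unfolding has_matrix_gradient_def using zero by simp
  qed
  also have "\<dots> \<longleftrightarrow> D = g - normal_part \<Lambda>"
  proof
    assume *: "\<forall>i<m. \<forall>j<n. ?X $$ (i, j) = 0"
    show "D = g - normal_part \<Lambda>"
    proof (rule eq_matI)
      fix i j assume "i < dim_row (g - normal_part \<Lambda>)" "j < dim_col (g - normal_part \<Lambda>)"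
      then have ij: "i < m" "j < n" using np g by auto
      then have "?X $$ (i, j) = 0" using * by blast
      then show "D $$ (i, j) = (g - normal_part \<Lambda>) $$ (i, j)" using ij np g D by auto
    qed (use np g D in auto)
  qed (use np g in auto)
  finally show ?thesis .
qed

text \<open>Stationarity says \<open>D = g - normal_part \<Lambda>\<close>. Feasibility of
  \<open>D\<close> then gives the system; conversely, a solution of the system yields this equation
  because the minimiser is unique.\<close>

lemma lagrange_multipliers_iff:
  assumes g: "g \<in> carrier_mat m n" and D: "is_projected_gradient g feasible D"
  shows "lagrange_multipliers g N G H D \<Lambda> \<longleftrightarrow> solves_multiplier_system g N G H \<Lambda>"
proof -
  have D': "D \<in> carrier_mat m n" "feasible D"
    using D g by (auto simp: is_projected_gradient_def is_arg_min_def)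
  have "lagrange_multipliers g N G H D \<Lambda> \<longleftrightarrow> multipliers \<Lambda> \<and> D = g - normal_part \<Lambda>"
  proof -
    have "dim_row g = m" "dim_col g = n" using g by auto
    then show ?thesis
      using lagrangian_gradient_zero_iff[OF g _ D'(1)]
      unfolding lagrange_multipliers_def by (metis multipliers_iff_dims)
  qed
  then show ?thesis
    using projected_gradient_multipliers[OF g] solves_multiplier_system_iff[OF g] D D' by blast
qed

end

section \<open>A single constraint\<close>

lemma gram_matrices_full_rank:
  assumes "G \<in> carrier_mat p m" "full_row_rank G" "H \<in> carrier_mat n q" "full_col_rank H"
  shows "det (G * G\<^sup>T) \<noteq> 0" "det (H\<^sup>T * H) \<noteq> 0"
proof -
  \<comment> \<open>\<open>G * G\<^sup>T\<close> is the Gram matrix of \<open>G\<^sup>T\<close>; the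
    double transpose matches the form in \<open>gram_invertible\<close>.\<close>
  have "det ((G\<^sup>T)\<^sup>T * G\<^sup>T) \<noteq> 0"
    using assms(1) full_row_rank_transpose_injective[OF assms(1,2)]
    by (intro gram_invertible[of _ m p]) auto
  then show "det (G * G\<^sup>T) \<noteq> 0" by simp
  show "det (H\<^sup>T * H) \<noteq> 0"
    using full_col_rank_injective[OF assms(3,4)] by (rule gram_invertible[OF assms(3)])
qed

lemma projected_gradient_single:
  assumes g: "g \<in> carrier_mat m n" and G: "G \<in> carrier_mat p m" and H: "H \<in> carrier_mat n q"
    and detG: "det (G * G\<^sup>T) \<noteq> 0" and detH: "det (H\<^sup>T * H) \<noteq> 0"
  shows "is_projected_gradient g (\<lambda>E. G * E * H = 0\<^sub>m p q) D \<longleftrightarrow>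
    D = g - G\<^sup>T * mat_inv (G * G\<^sup>T) * G * g * H * mat_inv (H\<^sup>T * H) * H\<^sup>T"
proof -
  define P where "P = mat_inv (G * G\<^sup>T)"
  define R where "R = mat_inv (H\<^sup>T * H)"
  have GG: "G * G\<^sup>T \<in> carrier_mat p p" and HH: "H\<^sup>T * H \<in> carrier_mat q q" using G H by auto
  have P: "P \<in> carrier_mat p p" "G * G\<^sup>T * P = 1\<^sub>m p"
    unfolding P_def using mat_inv_det_nonzero[OF GG detG] by auto
  have R: "R \<in> carrier_mat q q" "R * (H\<^sup>T * H) = 1\<^sub>m q"
    unfolding R_def using mat_inv_det_nonzero[OF HH detH] by auto
  define Y where "Y = G * g * H"
  \<comment> \<open>The multiplier: the only equation is
    \<open>G * G\<^sup>T * L * H\<^sup>T * H = Y\<close>, and the inverse Gram matrices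
    \<open>P\<close> and \<open>R\<close> solve it for \<open>L\<close>.\<close>
  define L where "L = P * Y * R"
  have Y: "Y \<in> carrier_mat p q" using G g H by (auto simp: Y_def)
  have L: "L \<in> carrier_mat p q" using P R Y by (auto simp: L_def)
  have 1: "G\<^sup>T * P * G * g * H * R * H\<^sup>T = G\<^sup>T * L * H\<^sup>T"
  proof -
    have "G\<^sup>T * P * G * g = G\<^sup>T * P * (G * g)"
      using G P g by (intro assoc_mult_mat) auto
    also have "\<dots> * H = G\<^sup>T * P * Y"
      unfolding Y_def using G P g H by (intro assoc_mult_mat) auto
    also have "\<dots> = G\<^sup>T * (P * Y)"
      using G P Y by (intro assoc_mult_mat) auto
    also have "\<dots> * R = G\<^sup>T * L"
      unfolding L_def using G P Y R by (intro assoc_mult_mat) auto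
    finally show ?thesis by simp
  qed
  have 2: "G * (G\<^sup>T * L * H\<^sup>T) * H = Y"
  proof -
    have "G * (G\<^sup>T * L * H\<^sup>T) = G * (G\<^sup>T * L) * H\<^sup>T"
      using G H L by (intro assoc_mult_mat[symmetric]) auto
    also have "G * (G\<^sup>T * L) = G * G\<^sup>T * L"
      using G H L by (intro assoc_mult_mat[symmetric]) auto
    also have "\<dots> = G * G\<^sup>T * (P * Y) * R"
      unfolding L_def using G P Y R by (intro assoc_mult_mat[symmetric]) auto
    also have "G * G\<^sup>T * (P * Y) = G * G\<^sup>T * P * Y"
      using G P Y R by (intro assoc_mult_mat[symmetric]) auto
    also have "\<dots> = Y" using P Y by simp
    also have "Y * R * H\<^sup>T * H = Y * R * (H\<^sup>T * H)"
      using Y R H by (intro assoc_mult_mat) auto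
    also have "\<dots> = Y * (R * (H\<^sup>T * H))"
      using Y R H by (intro assoc_mult_mat) auto
    also have "\<dots> = Y" using R Y by simp
    finally show ?thesis .
  qed
  define Z where "Z = G\<^sup>T * L * H\<^sup>T"
  have Z: "Z \<in> carrier_mat m n" using G H L by (auto simp: Z_def)
  have diff: "G * (E - F) * H = G * E * H - G * F * H"
    if "E \<in> carrier_mat m n" "F \<in> carrier_mat m n" for E F
    using G that H by (rule sandwich_minus)
  have 3: "G * (g - Z) * H = 0\<^sub>m p q"
    using diff[OF g Z] 2 Y by (simp add: Z_def[symmetric] Y_def[symmetric])
  have 4: "g - (g - Z) = Z" using g Z by (intro eq_matI) auto
  have "is_projected_gradient g (\<lambda>E. G * E * H = 0\<^sub>m p q) D \<longleftrightarrow> D = g - Z"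
  proof (rule projected_gradient_iff[OF g])
    show "g - Z \<in> carrier_mat m n" "G * (g - Z) * H = 0\<^sub>m p q" using g Z 3 by auto
    fix F assume F: "F \<in> carrier_mat m n" "G * F * H = 0\<^sub>m p q"
    show "G * (g - Z - F) * H = 0\<^sub>m p q"
      using diff[OF minus_carrier_mat[OF Z] F(1), of g] F(2) 3 by simp
    show "frob_inner (g - (g - Z)) F = 0"
      unfolding 4 using frob_inner_sandwich[OF L G F(1) H] F L
      by (simp add: Z_def frob_inner_zero_right)
  qed
  then show ?thesis using 1 by (simp add: P_def R_def Z_def)
qed

theorem lemma3:
  fixes n m :: nat
    and A B Q R K dJ :: "real mat"
    and x0 :: "real vec"
  assumes "A \<in> carrier_mat n n" and "B \<in> carrier_mat n m"
    and "pos_semidef n Q" and "pos_def m R"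
    and "x0 \<in> carrier_vec n"
    and "K \<in> carrier_mat m n" and "stabilizing A B K"
    and "has_matrix_gradient (lqr_cost A B Q R x0) K dJ"
    and "dJ \<noteq> 0\<^sub>m m n"
  shows
    "(\<forall>p q G H.
        G \<in> carrier_mat p m \<and> full_row_rank G \<and>
        H \<in> carrier_mat n q \<and> full_col_rank H \<longrightarrow>
        invertible_mat (G * G\<^sup>T) \<and> invertible_mat (H\<^sup>T * H) \<and>
        (\<forall>D. is_projected_gradient dJ (\<lambda>E. G * E * H = 0\<^sub>m p q) D \<longleftrightarrow>
           D = dJ - G\<^sup>T * mat_inv (G * G\<^sup>T) * G * dJ * H * mat_inv (H\<^sup>T * H) * H\<^sup>T))
     \<and>
     (\<forall>(N::nat) p q G H.
        (\<forall>i \<in> {1..N}. G i \<in> carrier_mat (p i) m \<and> full_row_rank (G i) \<and>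
                      H i \<in> carrier_mat n (q i) \<and> full_col_rank (H i)) \<longrightarrow>
        (\<exists>\<Lambda>. solves_multiplier_system dJ N G H \<Lambda>) \<and>
        (\<forall>\<Lambda>. solves_multiplier_system dJ N G H \<Lambda> \<longrightarrow>
           (\<forall>D. is_projected_gradient dJ (\<lambda>E. \<forall>i \<in> {1..N}. G i * E * H i = 0\<^sub>m (p i) (q i)) D \<longleftrightarrow>
              D = dJ - mat_sum m n (\<lambda>i. (G i)\<^sup>T * \<Lambda> i * (H i)\<^sup>T) {1..N})) \<and>
        (\<forall>D \<Lambda>. is_projected_gradient dJ (\<lambda>E. \<forall>i \<in> {1..N}. G i * E * H i = 0\<^sub>m (p i) (q i)) D \<longrightarrow>
           (lagrange_multipliers dJ N G H D \<Lambda> \<longleftrightarrow> solves_multiplier_system dJ N G H \<Lambda>)))"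
proof -
  \<comment> \<open>A matrix gradient at \<open>K\<close> has the shape of \<open>K\<close>.\<close>
  have g: "dJ \<in> carrier_mat m n"
    using assms(6,8) by (auto simp: has_matrix_gradient_def)
  show ?thesis
  \<comment> \<open>The six goals: invertibility of the two Gram matrices, the closed formula,
    solvability of the system, the projection for several constraints, and the multipliers.\<close>
  proof (intro conjI allI impI, goal_cases)
    case (1 p q G H)
    then have "det (G * G\<^sup>T) \<noteq> 0" "G * G\<^sup>T \<in> carrier_mat p p"
      using gram_matrices_full_rank(1)[of G p m H n q] by auto
    then show ?case using mat_inv_det_nonzero(4) by blast
  next
    case (2 p q G H)
    then have "det (H\<^sup>T * H) \<noteq> 0" "H\<^sup>T * H \<in> carrier_mat q q"
      using gram_matrices_full_rank(2)[of G p m H n q] by auto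
    then show ?case using mat_inv_det_nonzero(4) by blast
  next
    case (3 p q G H D)
    then have G: "G \<in> carrier_mat p m" "full_row_rank G" and H: "H \<in> carrier_mat n q" "full_col_rank H"
      by blast+
    show ?case
      by (rule projected_gradient_single[OF g G(1) H(1) gram_matrices_full_rank[OF G H]])
  next
    case (4 N p q G H)
    then interpret constraint_family m n N p q G H by unfold_locales auto
    show ?case by (rule multiplier_system_solvable[OF g])
  next
    case (5 N p q G H \<Lambda> D)
    then interpret constraint_family m n N p q G H by unfold_locales auto
    show ?case
      using projected_gradient_multipliers[OF g 5(2), of D]
      unfolding feasible_def[abs_def] normal_part_def .
  next
    case (6 N p q G H D \<Lambda>)
    then interpret constraint_family m n N p q G H by unfold_locales auto
    show ?case
      using lagrange_multipliers_iff[OF g 6(2)[folded feasible_def[abs_def]]] .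
  qed
qed

end
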